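(* Let $(A,\cdot,\Delta_A)$ be an alternative bialgebra, $E$ a vector space containing $A$ as a subspace and $V$ a complement of $A$ in $E$. Let $\mathcal{HLB}(V,A):=\big(\mathcal{IB}^{(1)}(A,V)\sqcup\mathcal{IB}^{(2)}(A,V)\big)/\equiv$. Then the map $$\Upsilon:\mathcal{HLB}(V,A)\to BExtd(E,A),\qquad \overline{\Omega^{(1)}(A,V)}\mapsto A^{P}\#_{\theta}V,\quad \overline{\Omega^{(2)}(A,V)}\mapsto A_{\sigma}\#^{Q}V,$$ sending the equivalence class of an extending datum to the equivalence class of the corresponding unified product on $E=A\oplus V$, is bijective.
   Context: All vector spaces are over a fixed field of characteristic zero. $\tau(u\otimes v)=v\otimes u$, $\tau_{12}(u\otimes v\otimes w)=v\otimes u\otimes w$, $\tau_{23}(u\otimes v\otimes w)=u\otimes w\otimes v$. An alternative algebra is a vector space with a bilinear multiplication such that $(ab)c-a(bc)+(ba)c-b(ac)=0$ and $(ab)c-a(bc)+(ac)b-a(cb)=0$. An alternative coalgebra is a vector space with a linear map $\Delta(a)=a_1\otimes a_2$ such that $D:=(\Delta\otimes\mathrm{id})\Delta-(\mathrm{id}\otimes\Delta)\Delta$ satisfies $D=-\tau_{12}D$ and $D=-\tau_{23}D$. An alternative bialgebra is an alternative algebra which is also an alternative coalgebra such that $\Delta(ab)=a_1b\otimes a_2+a_2b\otimes a_1-a_2\otimes ba_1+b_1\otimes ab_2+b_1\otimes b_2a-ab_1\otimes b_2$ and $\Delta(ba)+\tau\Delta(ba)=a_1\otimes ba_2+ba_2\otimes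 a_1+b_1a\otimes b_2+b_2\otimes b_1a$. Homomorphisms are linear maps preserving multiplication and comultiplication. Identify $E=A\oplus V$; $i:A\to E$ is the inclusion and $p:E\to A$ the projection with kernel $V$. $\mathcal{IB}^{(1)}(A,V)$ is the set of extending data of type (I): systems of linear maps $\Omega^{(1)}(A,V)=(\triangleright,\triangleleft,\phi,\psi,\rho,\gamma,\theta,P,\cdot_V,\Delta_V)$ with $\triangleright:A\otimes V\to V$, $\triangleleft:V\otimes A\to V$, $\phi:A\to V\otimes A$, $\psi:A\to A\otimes V$, $\rho:V\to A\otimes V$, $\gamma:V\to V\otimes A$, $\theta:A\otimes A\to V$, $P:A\to V\otimes V$, $\cdot_V:V\otimes V\to V$, $\Delta_V:V\to V\otimes V$, such that the unified product $A^{P}\#_{\theta}V$, i.e. $A\oplus V$ with $(a+x)(b+y)=ab+(x\cdot_Vy+a\triangleright y+x\triangleleft b+\theta(a,b))$, $\Delta_E(a)=\Delta_A(a)+\phi(a)+\psi(a)+P(a)$, $\Delta_E(x)=\Delta_V(x)+\rho(x)+\gamma(x)$, is an alternative bialgebra. $\mathcal{IB}^{(2)}(A,V)$ is the set of extending data of type (II): systems of linear maps $\Omega^{(2)}(A,V)=(\rightharpoonup,\leftharpoonup,\triangleright,\triangleleft,\sigma,\rho,\gamma,Q,\cdot_V,\Delta_V)$ with $\rightharpoonup:V\otimes A\to A$, $\leftharpoonup:A\otimes V\to A$, $\triangleright:A\otimes V\to V$, $\triangleleft:V\otimes A\to V$, $\sigma:V\otimes V\to A$, $\rho:V\to A\otimes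 V$, $\gamma:V\to V\otimes A$, $Q:V\to A\otimes A$, $\cdot_V:V\otimes V\to V$, $\Delta_V:V\to V\otimes V$, such that the unified product $A_{\sigma}\#^{Q}V$, i.e. $A\oplus V$ with $(a+x)(b+y)=(ab+x\rightharpoonup b+a\leftharpoonup y+\sigma(x,y))+(x\cdot_Vy+x\triangleleft b+a\triangleright y)$, $\Delta_E(a)=\Delta_A(a)$, $\Delta_E(x)=\Delta_V(x)+\rho(x)+\gamma(x)+Q(x)$, is an alternative bialgebra. Two extending data are equivalent, $\equiv$, if there are linear maps $r:V\to A$, $s:V\to V$ such that $\varphi_{r,s}(a+x)=(a+r(x))+s(x)$ is an isomorphism of alternative bialgebras between the corresponding unified products. $BExtd(E,A)$ is the set of equivalence classes of alternative bialgebra structures on $E$ for which $i$ or $p$ is a homomorphism of alternative bialgebras; two such structures are equivalent if there is an isomorphism of alternative bialgebras $\varphi:E\to E$ between them with $\varphi(a)=a$ for all $a\in A$. *)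

theory Defs
  imports Complex_Main "HOL-Library.Function_Algebras"
begin

section \<open>Tensor products of vector spaces\<close>

definition bilinear ::
  "('k::field \<Rightarrow> 'a::ab_group_add \<Rightarrow> 'a) \<Rightarrow> ('k \<Rightarrow> 'b::ab_group_add \<Rightarrow> 'b) \<Rightarrow> ('k \<Rightarrow> 'c::ab_group_add \<Rightarrow> 'c)
    \<Rightarrow> ('a \<Rightarrow> 'b \<Rightarrow> 'c) \<Rightarrow> bool"
  where "bilinear sA sB sC f \<longleftrightarrow>
    (\<forall>a. Vector_Spaces.linear sB sC (\<lambda>b. f a b)) \<and> (\<forall>b. Vector_Spaces.linear sA sC (\<lambda>a. f a b))"

definition trilinear ::
  "('k::field \<Rightarrow> 'a::ab_group_add \<Rightarrow> 'a) \<Rightarrow> ('k \<Rightarrow> 'b::ab_group_add \<Rightarrow> 'b) \<Rightarrow> ('k \<Rightarrow> 'c::ab_group_add \<Rightarrow> 'c)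
    \<Rightarrow> ('k \<Rightarrow> 'd::ab_group_add \<Rightarrow> 'd) \<Rightarrow> ('a \<Rightarrow> 'b \<Rightarrow> 'c \<Rightarrow> 'd) \<Rightarrow> bool"
  where "trilinear sA sB sC sD f \<longleftrightarrow>
    (\<forall>a. bilinear sB sC sD (\<lambda>b c. f a b c)) \<and> (\<forall>b. bilinear sA sC sD (\<lambda>a c. f a b c)) \<and>
    (\<forall>c. bilinear sA sB sD (\<lambda>a b. f a b c))"

text \<open>
  A tensor is represented by its values on bilinear forms: the pure tensor of \<open>a\<close> and \<open>b\<close>
  sends a bilinear form \<open>\<beta>\<close> to \<open>\<beta> a b\<close> (and anything else to 0), and the tensor product is the
  span of the pure tensors.  Over a field this is a tensor product; its universal property is
  the theorem \<open>tensor_universal\<close> below.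
\<close>

type_synonym ('k, 'a, 'b) tensor = "('a \<Rightarrow> 'b \<Rightarrow> 'k) \<Rightarrow> 'k"
type_synonym ('k, 'a, 'b, 'c) tensor3 = "('a \<Rightarrow> 'b \<Rightarrow> 'c \<Rightarrow> 'k) \<Rightarrow> 'k"

definition pure ::
  "('k::field \<Rightarrow> 'a::ab_group_add \<Rightarrow> 'a) \<Rightarrow> ('k \<Rightarrow> 'b::ab_group_add \<Rightarrow> 'b) \<Rightarrow> 'a \<Rightarrow> 'b \<Rightarrow> ('k, 'a, 'b) tensor"
  where "pure sA sB a b = (\<lambda>\<beta>. if bilinear sA sB (*) \<beta> then \<beta> a b else 0)"

definition pure3 ::
  "('k::field \<Rightarrow> 'a::ab_group_add \<Rightarrow> 'a) \<Rightarrow> ('k \<Rightarrow> 'b::ab_group_add \<Rightarrow> 'b) \<Rightarrow> ('k \<Rightarrow> 'c::ab_group_add \<Rightarrow> 'c)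
    \<Rightarrow> 'a \<Rightarrow> 'b \<Rightarrow> 'c \<Rightarrow> ('k, 'a, 'b, 'c) tensor3"
  where "pure3 sA sB sC a b c = (\<lambda>\<beta>. if trilinear sA sB sC (*) \<beta> then \<beta> a b c else 0)"

definition tscale :: "'k::field \<Rightarrow> ('f \<Rightarrow> 'k) \<Rightarrow> ('f \<Rightarrow> 'k)"
  where "tscale c t = (\<lambda>\<beta>. c * t \<beta>)"

definition tensor_space ::
  "('k::field \<Rightarrow> 'a::ab_group_add \<Rightarrow> 'a) \<Rightarrow> ('k \<Rightarrow> 'b::ab_group_add \<Rightarrow> 'b) \<Rightarrow> ('k, 'a, 'b) tensor set"
  where "tensor_space sA sB = module.span tscale {pure sA sB a b | a b. True}"

text \<open>
  If \<open>f\<close> is a bilinear map into another tensor product, then \<open>sweedler f\<close> is the induced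
  linear map with \<open>a \<otimes> b \<mapsto> f a b\<close>; thus \<open>sweedler (\<lambda>a\<^sub>1 a\<^sub>2. f a\<^sub>1 a\<^sub>2) (\<Delta> a)\<close>
  is the element written \<open>f a\<^sub>1 a\<^sub>2\<close> in Sweedler notation.
\<close>

definition sweedler :: "('a \<Rightarrow> 'b \<Rightarrow> ('f \<Rightarrow> 'k)) \<Rightarrow> ('k, 'a, 'b) tensor \<Rightarrow> ('f \<Rightarrow> 'k)"
  where "sweedler f t = (\<lambda>\<gamma>. t (\<lambda>a b. f a b \<gamma>))"

definition sweedler3 :: "('a \<Rightarrow> 'b \<Rightarrow> 'c \<Rightarrow> ('f \<Rightarrow> 'k)) \<Rightarrow> ('k, 'a, 'b, 'c) tensor3 \<Rightarrow> ('f \<Rightarrow> 'k)"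
  where "sweedler3 f t = (\<lambda>\<gamma>. t (\<lambda>a b c. f a b c \<gamma>))"

definition tensor_map ::
  "('k::field \<Rightarrow> 'c::ab_group_add \<Rightarrow> 'c) \<Rightarrow> ('k \<Rightarrow> 'd::ab_group_add \<Rightarrow> 'd)
    \<Rightarrow> ('a \<Rightarrow> 'c) \<Rightarrow> ('b \<Rightarrow> 'd) \<Rightarrow> ('k, 'a, 'b) tensor \<Rightarrow> ('k, 'c, 'd) tensor"
  where "tensor_map sC sD f g = sweedler (\<lambda>a b. pure sC sD (f a) (g b))"

definition linear_into_tensor ::
  "('k::field \<Rightarrow> 'a::ab_group_add \<Rightarrow> 'a) \<Rightarrow> ('k \<Rightarrow> 'b::ab_group_add \<Rightarrow> 'b) \<Rightarrow> ('k \<Rightarrow> 'c::ab_group_add \<Rightarrow> 'c)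
    \<Rightarrow> ('a \<Rightarrow> ('k, 'b, 'c) tensor) \<Rightarrow> bool"
  where "linear_into_tensor sA sB sC f \<longleftrightarrow>
    Vector_Spaces.linear sA tscale f \<and> (\<forall>a. f a \<in> tensor_space sB sC)"

lemma vector_space_tscale: "vector_space (tscale :: 'k::field \<Rightarrow> ('f \<Rightarrow> 'k) \<Rightarrow> ('f \<Rightarrow> 'k))"
  by unfold_locales (auto simp: tscale_def fun_eq_iff algebra_simps)

lemma vector_space_field: "vector_space ((*) :: 'k::field \<Rightarrow> 'k \<Rightarrow> 'k)"
  by unfold_locales (auto simp: algebra_simps)

lemma bilinear_pure:
  assumes "vector_space sA" "vector_space sB"
  shows "bilinear sA sB tscale (pure sA sB)"
proof -
  interpret A: vector_space sA by fact
  interpret B: vector_space sB by fact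
  interpret T: vector_space "tscale :: 'a \<Rightarrow> ('f \<Rightarrow> 'a) \<Rightarrow> ('f \<Rightarrow> 'a)" by (rule vector_space_tscale)
  have lin: "Vector_Spaces.linear sB (*) (\<beta> a)" "Vector_Spaces.linear sA (*) (\<lambda>a. \<beta> a b)"
    if "bilinear sA sB (*) \<beta>" for \<beta> :: "'b \<Rightarrow> 'c \<Rightarrow> 'a" and a b
    using that by (auto simp: bilinear_def)
  have scale: "module_hom sB (*) (\<beta> a)" "module_hom sA (*) (\<lambda>a. \<beta> a b)"
    if "bilinear sA sB (*) \<beta>" for \<beta> :: "'b \<Rightarrow> 'c \<Rightarrow> 'a" and a b
    using lin[OF that] by (auto simp: Vector_Spaces.linear_def)
  show ?thesis
    unfolding bilinear_def
  proof (intro conjI allI)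
    fix a
    show "Vector_Spaces.linear sB tscale (pure sA sB a)"
      by unfold_locales (simp_all add: pure_def tscale_def fun_eq_iff
        module_hom.add[OF scale(1)] module_hom.scale[OF scale(1)])
  next
    fix b
    show "Vector_Spaces.linear sA tscale (\<lambda>a. pure sA sB a b)"
      by unfold_locales (simp_all add: pure_def tscale_def fun_eq_iff
        module_hom.add[OF scale(2)] module_hom.scale[OF scale(2)])
  qed
qed

lemma sweedler_pure:
  assumes "vector_space sA" "vector_space sB" "bilinear sA sB tscale f"
  shows "sweedler f (pure sA sB a b) = f a b"
proof -
  have *: "Vector_Spaces.linear s (*) (\<lambda>x. g x \<gamma>)" if "Vector_Spaces.linear s tscale g"
    for s :: "'a \<Rightarrow> 'x::ab_group_add \<Rightarrow> 'x" and g :: "'x \<Rightarrow> 'd \<Rightarrow> 'a" and \<gamma>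
  proof -
    interpret g: Vector_Spaces.linear s tscale g by fact
    interpret K: vector_space "(*) :: 'a \<Rightarrow> 'a \<Rightarrow> 'a" by (rule vector_space_field)
    show ?thesis
      by unfold_locales (auto simp: g.add g.scale tscale_def)
  qed
  have "bilinear sA sB (*) (\<lambda>a b. f a b \<gamma>)" for \<gamma>
    using assms(3) unfolding bilinear_def by (auto intro: *)
  then show ?thesis by (simp add: sweedler_def pure_def)
qed

lemma linear_functionals_separate:
  assumes "vector_space s" and "\<And>l. Vector_Spaces.linear s (*) l \<Longrightarrow> l w = 0"
  shows "w = 0"
proof (rule ccontr)
  assume "w \<noteq> 0"
  interpret W: vector_space s by fact
  interpret K: vector_space "(*) :: 'a \<Rightarrow> 'a \<Rightarrow> 'a" by (rule vector_space_field)
  interpret WK: vector_space_pair s "(*) :: 'a \<Rightarrow> 'a \<Rightarrow> 'a" ..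
  have "W.independent {w}" using \<open>w \<noteq> 0\<close> by simp
  from WK.linear_independent_extend[OF this, of "\<lambda>_. 1"]
  obtain l where "Vector_Spaces.linear s (*) l" "l w = 1" by auto
  with assms(2)[of l] show False by simp
qed

theorem tensor_universal:
  fixes sA :: "'k::field \<Rightarrow> 'a::ab_group_add \<Rightarrow> 'a" and sB :: "'k \<Rightarrow> 'b::ab_group_add \<Rightarrow> 'b"
    and sC :: "'k \<Rightarrow> 'c::ab_group_add \<Rightarrow> 'c"
  assumes vs: "vector_space sA" "vector_space sB" "vector_space sC" and f: "bilinear sA sB sC f"
  shows "\<exists>F. Vector_Spaces.linear tscale sC F \<and> (\<forall>a b. F (pure sA sB a b) = f a b)"
    and "\<lbrakk>Vector_Spaces.linear tscale sC F; Vector_Spaces.linear tscale sC G;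
          \<forall>a b. F (pure sA sB a b) = f a b; \<forall>a b. G (pure sA sB a b) = f a b;
          t \<in> tensor_space sA sB\<rbrakk> \<Longrightarrow> F t = G t"
proof -
  interpret C: vector_space sC by fact
  interpret T: vector_space "tscale :: 'k \<Rightarrow> ('k, 'a, 'b) tensor \<Rightarrow> ('k, 'a, 'b) tensor"
    by (rule vector_space_tscale)
  interpret TC: vector_space_pair "tscale :: 'k \<Rightarrow> ('k, 'a, 'b) tensor \<Rightarrow> ('k, 'a, 'b) tensor" sC ..
  let ?P = "{pure sA sB a b | a b. True}"
  obtain B where B: "B \<subseteq> ?P" "T.independent B" "?P \<subseteq> T.span B"
    by (rule T.maximal_independent_subset)
  have "\<forall>x\<in>B. \<exists>u v. x = pure sA sB u v" using B(1) by blast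
  from bchoice[OF this] obtain u where "\<forall>x\<in>B. \<exists>v. x = pure sA sB (u x) v" by blast
  from bchoice[OF this] obtain v where uv: "\<And>x. x \<in> B \<Longrightarrow> x = pure sA sB (u x) (v x)" by blast
  obtain F where F: "Vector_Spaces.linear tscale sC F" "\<And>x. x \<in> B \<Longrightarrow> F x = f (u x) (v x)"
    using TC.linear_independent_extend[OF B(2), of "\<lambda>x. f (u x) (v x)"] by auto
  interpret F: Vector_Spaces.linear tscale sC F by fact
  have "F (pure sA sB a b) = f a b" for a b
  proof -
    have "pure sA sB a b \<in> T.span B" using B(3) by blast
    then obtain S c where S: "finite S" "S \<subseteq> B" "pure sA sB a b = (\<Sum>x\<in>S. tscale (c x) x)"
      unfolding T.span_explicit by blast
    have Fab: "F (pure sA sB a b) = (\<Sum>x\<in>S. sC (c x) (f (u x) (v x)))"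
      using S(2) F(2) by (auto simp: S(3) F.sum F.scale intro!: sum.cong)
    have "(\<Sum>x\<in>S. sC (c x) (f (u x) (v x))) - f a b = 0"
    proof (rule linear_functionals_separate[OF vs(3)])
      fix l :: "'c \<Rightarrow> 'k" assume l: "Vector_Spaces.linear sC (*) l"
      then interpret l: Vector_Spaces.linear sC "(*)" l .
      have bil: "bilinear sA sB (*) (\<lambda>a b. l (f a b))"
        unfolding bilinear_def
      proof (intro conjI allI)
        show "Vector_Spaces.linear sB (*) (\<lambda>b. l (f a b))" for a
          using Vector_Spaces.linear_compose[of sB sC "f a" "(*)" l] f l
          by (simp add: bilinear_def o_def)
        show "Vector_Spaces.linear sA (*) (\<lambda>a. l (f a b))" for b
          using Vector_Spaces.linear_compose[of sA sC "\<lambda>a. f a b" "(*)" l] f l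
          by (simp add: bilinear_def o_def)
      qed
      have app: "(\<Sum>x\<in>S. g x) \<beta> = (\<Sum>x\<in>S. g x \<beta>)" for g :: "_ \<Rightarrow> ('k, 'a, 'b) tensor" and \<beta>
        by (induction S rule: infinite_finite_induct) auto
      have "l (f a b) = pure sA sB a b (\<lambda>a b. l (f a b))" using bil by (simp add: pure_def)
      also have "\<dots> = (\<Sum>x\<in>S. c x * x (\<lambda>a b. l (f a b)))"
        by (simp add: S(3) app) (simp add: tscale_def)
      also have "\<dots> = (\<Sum>x\<in>S. c x * l (f (u x) (v x)))"
      proof (rule sum.cong)
        fix x assume "x \<in> S"
        then have "x = pure sA sB (u x) (v x)" using uv S(2) by blast
        then have "x (\<lambda>a b. l (f a b)) = pure sA sB (u x) (v x) (\<lambda>a b. l (f a b))" by metis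
        then show "c x * x (\<lambda>a b. l (f a b)) = c x * l (f (u x) (v x))"
          using bil by (simp add: pure_def)
      qed simp
      finally show "l ((\<Sum>x\<in>S. sC (c x) (f (u x) (v x))) - f a b) = 0"
        by (simp add: l.diff l.sum l.scale)
    qed
    then show ?thesis using Fab by simp
  qed
  with F(1) show "\<exists>F. Vector_Spaces.linear tscale sC F \<and> (\<forall>a b. F (pure sA sB a b) = f a b)"
    by blast
next
  assume F: "Vector_Spaces.linear tscale sC F" and G: "Vector_Spaces.linear tscale sC G"
    and eq: "\<forall>a b. F (pure sA sB a b) = f a b" "\<forall>a b. G (pure sA sB a b) = f a b"
    and t: "t \<in> tensor_space sA sB"
  interpret C: vector_space sC by fact
  interpret T: vector_space "tscale :: 'k \<Rightarrow> ('k, 'a, 'b) tensor \<Rightarrow> ('k, 'a, 'b) tensor"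
    by (rule vector_space_tscale)
  interpret TC: vector_space_pair "tscale :: 'k \<Rightarrow> ('k, 'a, 'b) tensor \<Rightarrow> ('k, 'a, 'b) tensor" sC ..
  show "F t = G t"
    by (rule TC.linear_eq_on[OF F G t[unfolded tensor_space_def]]) (use eq in auto)
qed


section \<open>Alternative bialgebras\<close>

locale alternative_algebra =
  fixes scale :: "'k::field_char_0 \<Rightarrow> 'a::ab_group_add \<Rightarrow> 'a"
    and mult :: "'a \<Rightarrow> 'a \<Rightarrow> 'a" (infixl "\<cdot>" 70)
  assumes bilinear_mult: "bilinear scale scale scale (\<cdot>)"
    and left_alternative: "(a \<cdot> b) \<cdot> c - a \<cdot> (b \<cdot> c) + (b \<cdot> a) \<cdot> c - b \<cdot> (a \<cdot> c) = 0"
    and right_alternative: "(a \<cdot> b) \<cdot> c - a \<cdot> (b \<cdot> c) + (a \<cdot> c) \<cdot> b - a \<cdot> (c \<cdot> b) = 0"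

definition flip ::
  "('k::field \<Rightarrow> 'a::ab_group_add \<Rightarrow> 'a) \<Rightarrow> ('k, 'a, 'a) tensor \<Rightarrow> ('k, 'a, 'a) tensor"
  where "flip s = sweedler (\<lambda>u v. pure s s v u)"

definition flip12 ::
  "('k::field \<Rightarrow> 'a::ab_group_add \<Rightarrow> 'a) \<Rightarrow> ('k, 'a, 'a, 'a) tensor3 \<Rightarrow> ('k, 'a, 'a, 'a) tensor3"
  where "flip12 s = sweedler3 (\<lambda>u v w. pure3 s s s v u w)"

definition flip23 ::
  "('k::field \<Rightarrow> 'a::ab_group_add \<Rightarrow> 'a) \<Rightarrow> ('k, 'a, 'a, 'a) tensor3 \<Rightarrow> ('k, 'a, 'a, 'a) tensor3"
  where "flip23 s = sweedler3 (\<lambda>u v w. pure3 s s s u w v)"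

text \<open>The maps \<open>\<Delta> \<otimes> id\<close> and \<open>id \<otimes> \<Delta>\<close>, and the coassociator \<open>D = (\<Delta> \<otimes> id) \<Delta> - (id \<otimes> \<Delta>) \<Delta>\<close>.\<close>

definition comult_left ::
  "('k::field \<Rightarrow> 'a::ab_group_add \<Rightarrow> 'a) \<Rightarrow> ('a \<Rightarrow> ('k, 'a, 'a) tensor)
    \<Rightarrow> ('k, 'a, 'a) tensor \<Rightarrow> ('k, 'a, 'a, 'a) tensor3"
  where "comult_left s \<Delta> = sweedler (\<lambda>u v. sweedler (\<lambda>u\<^sub>1 u\<^sub>2. pure3 s s s u\<^sub>1 u\<^sub>2 v) (\<Delta> u))"

definition comult_right ::
  "('k::field \<Rightarrow> 'a::ab_group_add \<Rightarrow> 'a) \<Rightarrow> ('a \<Rightarrow> ('k, 'a, 'a) tensor)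
    \<Rightarrow> ('k, 'a, 'a) tensor \<Rightarrow> ('k, 'a, 'a, 'a) tensor3"
  where "comult_right s \<Delta> = sweedler (\<lambda>u v. sweedler (\<lambda>v\<^sub>1 v\<^sub>2. pure3 s s s u v\<^sub>1 v\<^sub>2) (\<Delta> v))"

definition coassociator ::
  "('k::field \<Rightarrow> 'a::ab_group_add \<Rightarrow> 'a) \<Rightarrow> ('a \<Rightarrow> ('k, 'a, 'a) tensor)
    \<Rightarrow> 'a \<Rightarrow> ('k, 'a, 'a, 'a) tensor3"
  where "coassociator s \<Delta> a = comult_left s \<Delta> (\<Delta> a) - comult_right s \<Delta> (\<Delta> a)"

locale alternative_coalgebra =
  fixes scale :: "'k::field_char_0 \<Rightarrow> 'a::ab_group_add \<Rightarrow> 'a"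
    and comult :: "'a \<Rightarrow> ('k, 'a, 'a) tensor" ("\<Delta>")
  assumes linear_comult: "linear_into_tensor scale scale scale \<Delta>"
    and coassociator_flip12: "coassociator scale \<Delta> a = - flip12 scale (coassociator scale \<Delta> a)"
    and coassociator_flip23: "coassociator scale \<Delta> a = - flip23 scale (coassociator scale \<Delta> a)"
begin

abbreviation pure_tensor :: "'a \<Rightarrow> 'a \<Rightarrow> ('k, 'a, 'a) tensor" (infix "\<otimes>" 68)
  where "u \<otimes> v \<equiv> pure scale scale u v"

end

locale alternative_bialgebra =
  alternative_algebra scale mult + alternative_coalgebra scale comult
  for scale :: "'k::field_char_0 \<Rightarrow> 'a::ab_group_add \<Rightarrow> 'a"
    and mult :: "'a \<Rightarrow> 'a \<Rightarrow> 'a" (infixl "\<cdot>" 70)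
    and comult :: "'a \<Rightarrow> ('k, 'a, 'a) tensor" ("\<Delta>") +
  assumes comult_mult:
    "\<Delta> (a \<cdot> b) =
       sweedler (\<lambda>a\<^sub>1 a\<^sub>2. (a\<^sub>1 \<cdot> b) \<otimes> a\<^sub>2 + (a\<^sub>2 \<cdot> b) \<otimes> a\<^sub>1 - a\<^sub>2 \<otimes> (b \<cdot> a\<^sub>1)) (\<Delta> a) +
       sweedler (\<lambda>b\<^sub>1 b\<^sub>2. b\<^sub>1 \<otimes> (a \<cdot> b\<^sub>2) + b\<^sub>1 \<otimes> (b\<^sub>2 \<cdot> a) - (a \<cdot> b\<^sub>1) \<otimes> b\<^sub>2) (\<Delta> b)"
    and comult_mult_flip:
    "\<Delta> (b \<cdot> a) + flip scale (\<Delta> (b \<cdot> a)) =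
       sweedler (\<lambda>a\<^sub>1 a\<^sub>2. a\<^sub>1 \<otimes> (b \<cdot> a\<^sub>2) + (b \<cdot> a\<^sub>2) \<otimes> a\<^sub>1) (\<Delta> a) +
       sweedler (\<lambda>b\<^sub>1 b\<^sub>2. (b\<^sub>1 \<cdot> a) \<otimes> b\<^sub>2 + b\<^sub>2 \<otimes> (b\<^sub>1 \<cdot> a)) (\<Delta> b)"

type_synonym ('k, 'a) bialg_structure = "('a \<Rightarrow> 'a \<Rightarrow> 'a) \<times> ('a \<Rightarrow> ('k, 'a, 'a) tensor)"

definition bialgebra_hom ::
  "('k::field \<Rightarrow> 'a::ab_group_add \<Rightarrow> 'a) \<Rightarrow> ('k, 'a) bialg_structure
    \<Rightarrow> ('k \<Rightarrow> 'b::ab_group_add \<Rightarrow> 'b) \<Rightarrow> ('k, 'b) bialg_structure \<Rightarrow> ('a \<Rightarrow> 'b) \<Rightarrow> bool"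
  where "bialgebra_hom sA S sB T f \<longleftrightarrow>
    Vector_Spaces.linear sA sB f \<and>
    (\<forall>x y. f (fst S x y) = fst T (f x) (f y)) \<and>
    (\<forall>x. tensor_map sB sB f f (snd S x) = snd T (f x))"

definition bialgebra_iso ::
  "('k::field \<Rightarrow> 'a::ab_group_add \<Rightarrow> 'a) \<Rightarrow> ('k, 'a) bialg_structure
    \<Rightarrow> ('k \<Rightarrow> 'b::ab_group_add \<Rightarrow> 'b) \<Rightarrow> ('k, 'b) bialg_structure \<Rightarrow> ('a \<Rightarrow> 'b) \<Rightarrow> bool"
  where "bialgebra_iso sA S sB T f \<longleftrightarrow> bialgebra_hom sA S sB T f \<and> bij f"


section \<open>A subspace with a complement\<close>

text \<open>
  The subspaces \<open>A\<close> and \<open>V\<close> of \<open>E\<close> are types of their own, with inclusions \<open>i\<close> and \<open>j\<close>;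
  the element \<open>a + x\<close> of \<open>E = A \<oplus> V\<close> is \<open>i a + j x\<close>.
\<close>

locale complemented_subspace =
  i: Vector_Spaces.linear sA sE i + j: Vector_Spaces.linear sV sE j
  for sA :: "'k::field \<Rightarrow> 'a::ab_group_add \<Rightarrow> 'a"
    and sV :: "'k \<Rightarrow> 'v::ab_group_add \<Rightarrow> 'v"
    and sE :: "'k \<Rightarrow> 'e::ab_group_add \<Rightarrow> 'e"
    and i :: "'a \<Rightarrow> 'e" and j :: "'v \<Rightarrow> 'e" +
  assumes inj_i: "inj i" and inj_j: "inj j"
    and inter: "range i \<inter> range j = {0}"
    and spanning: "\<forall>e. \<exists>a x. e = i a + j x"

definition projA :: "('a \<Rightarrow> 'e::ab_group_add) \<Rightarrow> ('v \<Rightarrow> 'e) \<Rightarrow> 'e \<Rightarrow> 'a"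
  where "projA i j e = (THE a. \<exists>x. e = i a + j x)"

definition projV :: "('a \<Rightarrow> 'e::ab_group_add) \<Rightarrow> ('v \<Rightarrow> 'e) \<Rightarrow> 'e \<Rightarrow> 'v"
  where "projV i j e = (THE x. \<exists>a. e = i a + j x)"

lemma (in complemented_subspace) proj_simps:
  "projA i j (i a + j x) = a" "projV i j (i a + j x) = x"
proof -
  have eq: "a = b \<and> x = y" if "i a + j x = i b + j y" for a b x y
  proof -
    have *: "i (a - b) = j (y - x)" using that by (simp add: i.diff j.diff algebra_simps)
    then have "i (a - b) \<in> range i \<inter> range j" by (metis IntI rangeI)
    with inter have "i (a - b) = 0" "j (y - x) = 0" using * by auto
    then have "a - b = 0" "y - x = 0"
      using inj_i inj_j i.zero j.zero by (metis injD)+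
    then show ?thesis by simp
  qed
  show "projA i j (i a + j x) = a" "projV i j (i a + j x) = x"
    unfolding projA_def projV_def by (blast dest: eq intro: the_equality)+
qed


section \<open>Extending data and unified products\<close>

text \<open>
  Linear maps out of a tensor product, such as \<open>A \<otimes> V \<rightarrow> V\<close>, are given as bilinear maps.
\<close>

record ('k, 'a, 'v) datum1 =
  lact1 :: "'a \<Rightarrow> 'v \<Rightarrow> 'v"  (* a \<triangleright> x *)
  ract1 :: "'v \<Rightarrow> 'a \<Rightarrow> 'v"  (* x \<triangleleft> a *)
  phi1 :: "'a \<Rightarrow> ('k, 'v, 'a) tensor"
  psi1 :: "'a \<Rightarrow> ('k, 'a, 'v) tensor"
  rho1 :: "'v \<Rightarrow> ('k, 'a, 'v) tensor"
  gamma1 :: "'v \<Rightarrow> ('k, 'v, 'a) tensor"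
  theta1 :: "'a \<Rightarrow> 'a \<Rightarrow> 'v"
  P1 :: "'a \<Rightarrow> ('k, 'v, 'v) tensor"
  mult1 :: "'v \<Rightarrow> 'v \<Rightarrow> 'v"
  comult1 :: "'v \<Rightarrow> ('k, 'v, 'v) tensor"

record ('k, 'a, 'v) datum2 =
  lharp2 :: "'v \<Rightarrow> 'a \<Rightarrow> 'a"  (* x \<rightharpoonup> a *)
  rharp2 :: "'a \<Rightarrow> 'v \<Rightarrow> 'a"  (* a \<leftharpoonup> x *)
  lact2 :: "'a \<Rightarrow> 'v \<Rightarrow> 'v"  (* a \<triangleright> x *)
  ract2 :: "'v \<Rightarrow> 'a \<Rightarrow> 'v"  (* x \<triangleleft> a *)
  sigma2 :: "'v \<Rightarrow> 'v \<Rightarrow> 'a"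
  rho2 :: "'v \<Rightarrow> ('k, 'a, 'v) tensor"
  gamma2 :: "'v \<Rightarrow> ('k, 'v, 'a) tensor"
  Q2 :: "'v \<Rightarrow> ('k, 'a, 'a) tensor"
  mult2 :: "'v \<Rightarrow> 'v \<Rightarrow> 'v"
  comult2 :: "'v \<Rightarrow> ('k, 'v, 'v) tensor"

definition unified1 ::
  "('k::field \<Rightarrow> 'e::ab_group_add \<Rightarrow> 'e) \<Rightarrow> ('a::ab_group_add \<Rightarrow> 'e) \<Rightarrow> ('v::ab_group_add \<Rightarrow> 'e)
    \<Rightarrow> ('k, 'a) bialg_structure \<Rightarrow> ('k, 'a, 'v) datum1 \<Rightarrow> ('k, 'e) bialg_structure"
  where "unified1 sE i j S \<Omega> =
    (\<lambda>e f. let a = projA i j e; x = projV i j e; b = projA i j f; y = projV i j f in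
       i (fst S a b) + j (mult1 \<Omega> x y + lact1 \<Omega> a y + ract1 \<Omega> x b + theta1 \<Omega> a b),
     \<lambda>e. let a = projA i j e; x = projV i j e in
       (tensor_map sE sE i i (snd S a) + tensor_map sE sE j i (phi1 \<Omega> a)
         + tensor_map sE sE i j (psi1 \<Omega> a) + tensor_map sE sE j j (P1 \<Omega> a))
       + (tensor_map sE sE j j (comult1 \<Omega> x) + tensor_map sE sE i j (rho1 \<Omega> x)
         + tensor_map sE sE j i (gamma1 \<Omega> x)))"

definition unified2 ::
  "('k::field \<Rightarrow> 'e::ab_group_add \<Rightarrow> 'e) \<Rightarrow> ('a::ab_group_add \<Rightarrow> 'e) \<Rightarrow> ('v::ab_group_add \<Rightarrow> 'e)
    \<Rightarrow> ('k, 'a) bialg_structure \<Rightarrow> ('k, 'a, 'v) datum2 \<Rightarrow> ('k, 'e) bialg_structure"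
  where "unified2 sE i j S \<Omega> =
    (\<lambda>e f. let a = projA i j e; x = projV i j e; b = projA i j f; y = projV i j f in
       i (fst S a b + lharp2 \<Omega> x b + rharp2 \<Omega> a y + sigma2 \<Omega> x y)
       + j (mult2 \<Omega> x y + ract2 \<Omega> x b + lact2 \<Omega> a y),
     \<lambda>e. let a = projA i j e; x = projV i j e in
       tensor_map sE sE i i (snd S a)
       + (tensor_map sE sE j j (comult2 \<Omega> x) + tensor_map sE sE i j (rho2 \<Omega> x)
         + tensor_map sE sE j i (gamma2 \<Omega> x) + tensor_map sE sE i i (Q2 \<Omega> x)))"

definition IB1 ::
  "('k::field_char_0 \<Rightarrow> 'a::ab_group_add \<Rightarrow> 'a) \<Rightarrow> ('k \<Rightarrow> 'v::ab_group_add \<Rightarrow> 'v)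
    \<Rightarrow> ('k \<Rightarrow> 'e::ab_group_add \<Rightarrow> 'e) \<Rightarrow> ('a \<Rightarrow> 'e) \<Rightarrow> ('v \<Rightarrow> 'e) \<Rightarrow> ('k, 'a) bialg_structure
    \<Rightarrow> ('k, 'a, 'v) datum1 set"
  where "IB1 sA sV sE i j S = {\<Omega>.
    bilinear sA sV sV (lact1 \<Omega>) \<and> bilinear sV sA sV (ract1 \<Omega>) \<and>
    linear_into_tensor sA sV sA (phi1 \<Omega>) \<and> linear_into_tensor sA sA sV (psi1 \<Omega>) \<and>
    linear_into_tensor sV sA sV (rho1 \<Omega>) \<and> linear_into_tensor sV sV sA (gamma1 \<Omega>) \<and>
    bilinear sA sA sV (theta1 \<Omega>) \<and> linear_into_tensor sA sV sV (P1 \<Omega>) \<and>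
    bilinear sV sV sV (mult1 \<Omega>) \<and> linear_into_tensor sV sV sV (comult1 \<Omega>) \<and>
    alternative_bialgebra sE (fst (unified1 sE i j S \<Omega>)) (snd (unified1 sE i j S \<Omega>))}"

definition IB2 ::
  "('k::field_char_0 \<Rightarrow> 'a::ab_group_add \<Rightarrow> 'a) \<Rightarrow> ('k \<Rightarrow> 'v::ab_group_add \<Rightarrow> 'v)
    \<Rightarrow> ('k \<Rightarrow> 'e::ab_group_add \<Rightarrow> 'e) \<Rightarrow> ('a \<Rightarrow> 'e) \<Rightarrow> ('v \<Rightarrow> 'e) \<Rightarrow> ('k, 'a) bialg_structure
    \<Rightarrow> ('k, 'a, 'v) datum2 set"
  where "IB2 sA sV sE i j S = {\<Omega>.
    bilinear sV sA sA (lharp2 \<Omega>) \<and> bilinear sA sV sA (rharp2 \<Omega>) \<and>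
    bilinear sA sV sV (lact2 \<Omega>) \<and> bilinear sV sA sV (ract2 \<Omega>) \<and>
    bilinear sV sV sA (sigma2 \<Omega>) \<and>
    linear_into_tensor sV sA sV (rho2 \<Omega>) \<and> linear_into_tensor sV sV sA (gamma2 \<Omega>) \<and>
    linear_into_tensor sV sA sA (Q2 \<Omega>) \<and>
    bilinear sV sV sV (mult2 \<Omega>) \<and> linear_into_tensor sV sV sV (comult2 \<Omega>) \<and>
    alternative_bialgebra sE (fst (unified2 sE i j S \<Omega>)) (snd (unified2 sE i j S \<Omega>))}"

definition unified ::
  "('k::field \<Rightarrow> 'e::ab_group_add \<Rightarrow> 'e) \<Rightarrow> ('a::ab_group_add \<Rightarrow> 'e) \<Rightarrow> ('v::ab_group_add \<Rightarrow> 'e)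
    \<Rightarrow> ('k, 'a) bialg_structure \<Rightarrow> ('k, 'a, 'v) datum1 + ('k, 'a, 'v) datum2 \<Rightarrow> ('k, 'e) bialg_structure"
  where "unified sE i j S = case_sum (unified1 sE i j S) (unified2 sE i j S)"

definition varphi ::
  "('a \<Rightarrow> 'e::ab_group_add) \<Rightarrow> ('v \<Rightarrow> 'e) \<Rightarrow> ('v \<Rightarrow> 'a::ab_group_add) \<Rightarrow> ('v \<Rightarrow> 'v) \<Rightarrow> 'e \<Rightarrow> 'e"
  where "varphi i j r s e =
    i (projA i j e + r (projV i j e)) + j (s (projV i j e))"

definition datum_equiv ::
  "('k::field_char_0 \<Rightarrow> 'a::ab_group_add \<Rightarrow> 'a) \<Rightarrow> ('k \<Rightarrow> 'v::ab_group_add \<Rightarrow> 'v)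
    \<Rightarrow> ('k \<Rightarrow> 'e::ab_group_add \<Rightarrow> 'e) \<Rightarrow> ('a \<Rightarrow> 'e) \<Rightarrow> ('v \<Rightarrow> 'e) \<Rightarrow> ('k, 'a) bialg_structure
    \<Rightarrow> (('k, 'a, 'v) datum1 + ('k, 'a, 'v) datum2) rel"
  where "datum_equiv sA sV sE i j S =
    {(\<Omega>, \<Omega>'). \<Omega> \<in> IB1 sA sV sE i j S <+> IB2 sA sV sE i j S \<and>
      \<Omega>' \<in> IB1 sA sV sE i j S <+> IB2 sA sV sE i j S \<and>
      (\<exists>r s. Vector_Spaces.linear sV sA r \<and> Vector_Spaces.linear sV sV s \<and>
        bialgebra_iso sE (unified sE i j S \<Omega>) sE (unified sE i j S \<Omega>') (varphi i j r s))}"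

definition HLB ::
  "('k::field_char_0 \<Rightarrow> 'a::ab_group_add \<Rightarrow> 'a) \<Rightarrow> ('k \<Rightarrow> 'v::ab_group_add \<Rightarrow> 'v)
    \<Rightarrow> ('k \<Rightarrow> 'e::ab_group_add \<Rightarrow> 'e) \<Rightarrow> ('a \<Rightarrow> 'e) \<Rightarrow> ('v \<Rightarrow> 'e) \<Rightarrow> ('k, 'a) bialg_structure
    \<Rightarrow> (('k, 'a, 'v) datum1 + ('k, 'a, 'v) datum2) set set"
  where "HLB sA sV sE i j S =
    (IB1 sA sV sE i j S <+> IB2 sA sV sE i j S) // datum_equiv sA sV sE i j S"


section \<open>Extensions of the bialgebra structure to the ambient space\<close>

definition extensions ::
  "('k::field_char_0 \<Rightarrow> 'a::ab_group_add \<Rightarrow> 'a) \<Rightarrow> ('k \<Rightarrow> 'e::ab_group_add \<Rightarrow> 'e)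
    \<Rightarrow> ('a \<Rightarrow> 'e) \<Rightarrow> ('v \<Rightarrow> 'e) \<Rightarrow> ('k, 'a) bialg_structure \<Rightarrow> ('k, 'e) bialg_structure set"
  where "extensions sA sE i j S =
    {T. alternative_bialgebra sE (fst T) (snd T) \<and>
      (bialgebra_hom sA S sE T i \<or> bialgebra_hom sE T sA S (projA i j))}"

definition extension_equiv ::
  "('k::field_char_0 \<Rightarrow> 'a::ab_group_add \<Rightarrow> 'a) \<Rightarrow> ('k \<Rightarrow> 'e::ab_group_add \<Rightarrow> 'e)
    \<Rightarrow> ('a \<Rightarrow> 'e) \<Rightarrow> ('v \<Rightarrow> 'e) \<Rightarrow> ('k, 'a) bialg_structure \<Rightarrow> ('k, 'e) bialg_structure rel"
  where "extension_equiv sA sE i j S =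
    {(T, T'). T \<in> extensions sA sE i j S \<and> T' \<in> extensions sA sE i j S \<and>
      (\<exists>\<phi>. bialgebra_iso sE T sE T' \<phi> \<and> (\<forall>a. \<phi> (i a) = i a))}"

definition BExtd ::
  "('k::field_char_0 \<Rightarrow> 'a::ab_group_add \<Rightarrow> 'a) \<Rightarrow> ('k \<Rightarrow> 'e::ab_group_add \<Rightarrow> 'e)
    \<Rightarrow> ('a \<Rightarrow> 'e) \<Rightarrow> ('v \<Rightarrow> 'e) \<Rightarrow> ('k, 'a) bialg_structure \<Rightarrow> ('k, 'e) bialg_structure set set"
  where "BExtd sA sE i j S = extensions sA sE i j S // extension_equiv sA sE i j S"

end

theory Submission
  imports Defs
begin

text \<open>
  An extension along which the projection \<open>p\<close> (respectively the inclusion \<open>i\<close>) is a homomorphism is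
  the unified product of the datum of type (I) (respectively (II)) formed by the components of its
  multiplication and comultiplication with respect to \<open>E = A \<oplus> V\<close>, so forming the unified product
  is a surjection from data onto extensions.  A linear endomorphism of \<open>E\<close> fixes \<open>A\<close> pointwise
  iff it is some \<open>\<phi>\<^sub>r\<^sub>,\<^sub>s\<close>, so equivalence of data is the pullback of equivalence of extensions along
  this surjection, and the pullback of a relation along a surjection has the same quotient.
\<close>

section \<open>Linear maps and tensors\<close>

lemma bilinear_compose:
  assumes "bilinear sC sD sF \<beta>" "Vector_Spaces.linear sA sC f" "Vector_Spaces.linear sB sD g"
  shows "bilinear sA sB sF (\<lambda>a b. \<beta> (f a) (g b))"
  using assms by (simp add: bilinear_def Vector_Spaces.linear_iff)

lemma linear_bilinear_compose:
  assumes "Vector_Spaces.linear sC sD h" "bilinear sA sB sC \<beta>"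
  shows "bilinear sA sB sD (\<lambda>a b. h (\<beta> a b))"
  using assms by (simp add: bilinear_def Vector_Spaces.linear_iff)

lemma bilinear_zero:
  assumes "bilinear sA sB sC \<beta>"
  shows "\<beta> 0 b = 0" "\<beta> a 0 = 0"
proof -
  have "\<beta> (0 + 0) b = \<beta> 0 b + \<beta> 0 b" "\<beta> a (0 + 0) = \<beta> a 0 + \<beta> a 0"
    using assms unfolding bilinear_def Vector_Spaces.linear_iff by blast+
  then show "\<beta> 0 b = 0" "\<beta> a 0 = 0" by simp_all
qed

lemma bilinear_add:
  assumes "bilinear sA sB sC \<beta>"
  shows "\<beta> (a + a') b = \<beta> a b + \<beta> a' b" "\<beta> a (b + b') = \<beta> a b + \<beta> a b'"
  using assms unfolding bilinear_def Vector_Spaces.linear_iff by blast+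

lemma linear_zero: "Vector_Spaces.linear sA sB f \<Longrightarrow> f 0 = 0"
  by (metis add_cancel_right_right Vector_Spaces.linear_iff)

lemma tensor_map_add: "tensor_map sC sD f g (s + t) = tensor_map sC sD f g s + tensor_map sC sD f g t"
  by (simp add: tensor_map_def sweedler_def fun_eq_iff)

lemma tensor_map_tscale: "tensor_map sC sD f g (tscale c t) = tscale c (tensor_map sC sD f g t)"
  by (simp add: tensor_map_def sweedler_def tscale_def fun_eq_iff)

lemma tensor_map_0: "tensor_map sC sD f g 0 = 0"
  by (simp add: tensor_map_def sweedler_def fun_eq_iff)

lemma linear_tensor_map: "Vector_Spaces.linear tscale tscale (tensor_map sC sD f g)"
  by (simp add: Vector_Spaces.linear_iff vector_space_tscale tensor_map_add tensor_map_tscale)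

lemma tensor_map_pure:
  assumes "Vector_Spaces.linear sA sC f" "Vector_Spaces.linear sB sD g"
  shows "tensor_map sC sD f g (pure sA sB a b) = pure sC sD (f a) (g b)"
proof -
  have vs: "vector_space sA" "vector_space sB" "vector_space sC" "vector_space sD"
    using assms by (simp_all add: Vector_Spaces.linear_iff)
  show ?thesis
    unfolding tensor_map_def
    by (rule sweedler_pure[OF vs(1,2)]) (rule bilinear_compose[OF bilinear_pure[OF vs(3,4)] assms])
qed

lemma tensor_space_linear_eqI:
  assumes "Vector_Spaces.linear tscale tscale F" "Vector_Spaces.linear tscale tscale G"
    and "\<And>a b. F (pure sA sB a b) = G (pure sA sB a b)" and "t \<in> tensor_space sA sB"
  shows "F t = G t"
proof -
  interpret vector_space_pair tscale tscale
    by (simp add: vector_space_pair_def vector_space_tscale)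
  show ?thesis
    by (rule linear_eq_on[OF assms(1,2) assms(4)[unfolded tensor_space_def]]) (use assms(3) in auto)
qed

lemma pure_in_tensor_space: "pure sA sB a b \<in> tensor_space sA sB"
proof -
  interpret vector_space tscale by (rule vector_space_tscale)
  show ?thesis unfolding tensor_space_def by (rule span_base) blast
qed

lemma tensor_map_in_tensor_space:
  assumes f: "Vector_Spaces.linear sA sC f" and g: "Vector_Spaces.linear sB sD g"
    and t: "t \<in> tensor_space sA sB"
  shows "tensor_map sC sD f g t \<in> tensor_space sC sD"
proof -
  interpret T: module_hom tscale tscale "tensor_map sC sD f g"
    by (rule linear_tensor_map[unfolded Vector_Spaces.linear_def, THEN conjunct2, THEN conjunct2])
  show ?thesis
    using t unfolding tensor_space_def
  proof (rule T.m1.span_induct)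
    show "T.m1.subspace {t. tensor_map sC sD f g t \<in> T.m2.span {pure sC sD a b |a b. True}}"
      by (rule T.subspace_vimage[unfolded vimage_def]) (rule T.m2.subspace_span)
  qed (use pure_in_tensor_space[of sC sD] in
    \<open>auto simp: tensor_map_pure[OF f g] tensor_space_def\<close>)
qed

lemma tensor_map_compose:
  assumes "Vector_Spaces.linear sA sC f" "Vector_Spaces.linear sB sD g"
    and "Vector_Spaces.linear sC sF h" "Vector_Spaces.linear sD sG k"
    and "t \<in> tensor_space sA sB"
  shows "tensor_map sF sG h k (tensor_map sC sD f g t) = tensor_map sF sG (\<lambda>x. h (f x)) (\<lambda>x. k (g x)) t"
proof -
  have hf: "Vector_Spaces.linear sA sF (\<lambda>x. h (f x))" "Vector_Spaces.linear sB sG (\<lambda>x. k (g x))"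
    using assms by (simp_all add: Vector_Spaces.linear_iff)
  show ?thesis
    by (rule tensor_space_linear_eqI[OF _ linear_tensor_map _ assms(5)])
      (simp_all add: Vector_Spaces.linear_iff vector_space_tscale tensor_map_add tensor_map_tscale
        tensor_map_pure[OF assms(1,2)] tensor_map_pure[OF assms(3,4)] tensor_map_pure[OF hf])
qed

lemma linear_id: "vector_space s \<Longrightarrow> Vector_Spaces.linear s s (\<lambda>x. x)"
  by (simp add: Vector_Spaces.linear_iff)

lemma linear_const_0: "vector_space s \<Longrightarrow> vector_space s' \<Longrightarrow> Vector_Spaces.linear s s' (\<lambda>_. 0)"
  by (simp add: Vector_Spaces.linear_iff module.scale_zero_right module_iff_vector_space)

lemma tensor_map_id:
  assumes "vector_space sA" "vector_space sB" "t \<in> tensor_space sA sB"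
  shows "tensor_map sA sB (\<lambda>x. x) (\<lambda>x. x) t = t"
  by (rule tensor_space_linear_eqI[OF linear_tensor_map linear_id[OF vector_space_tscale] _ assms(3)])
    (simp add: tensor_map_pure[OF linear_id[OF assms(1)] linear_id[OF assms(2)]])

lemma tensor_map_zero:
  assumes "vector_space sC" "vector_space sD" "t \<in> tensor_space sA sB"
  shows "Vector_Spaces.linear sA sC f \<Longrightarrow> vector_space sB \<Longrightarrow> tensor_map sC sD f (\<lambda>_. 0) t = 0"
    and "Vector_Spaces.linear sB sD g \<Longrightarrow> vector_space sA \<Longrightarrow> tensor_map sC sD (\<lambda>_. 0) g t = 0"
proof -
  have 0: "Vector_Spaces.linear tscale tscale (\<lambda>_. 0)"
    by (rule linear_const_0[OF vector_space_tscale vector_space_tscale])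
  note z = bilinear_zero[OF bilinear_pure[OF assms(1,2)]]
  show "tensor_map sC sD f (\<lambda>_. 0) t = 0"
    if f: "Vector_Spaces.linear sA sC f" and B: "vector_space sB"
    by (rule tensor_space_linear_eqI[OF linear_tensor_map 0 _ assms(3)])
      (simp add: tensor_map_pure[OF f linear_const_0[OF B assms(2)]] z)
  show "tensor_map sC sD (\<lambda>_. 0) g t = 0"
    if g: "Vector_Spaces.linear sB sD g" and A: "vector_space sA"
    by (rule tensor_space_linear_eqI[OF linear_tensor_map 0 _ assms(3)])
      (simp add: tensor_map_pure[OF linear_const_0[OF A assms(1)] g] z)
qed

lemma linear_into_tensor_compose:
  assumes "linear_into_tensor sE sC sD \<Delta>" "Vector_Spaces.linear sA sE h"
    "Vector_Spaces.linear sC sF f" "Vector_Spaces.linear sD sG g"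
  shows "linear_into_tensor sA sF sG (\<lambda>x. tensor_map sF sG f g (\<Delta> (h x)))"
  using assms tensor_map_in_tensor_space[OF assms(3,4)]
  by (simp add: linear_into_tensor_def Vector_Spaces.linear_iff vector_space_tscale
      tensor_map_add tensor_map_tscale)

lemma linear_into_tensor_0: "linear_into_tensor sA sB sC f \<Longrightarrow> f 0 = 0"
  by (auto simp: linear_into_tensor_def intro: linear_zero)

section \<open>The projections of a complemented subspace\<close>

context complemented_subspace
begin

abbreviation p where "p \<equiv> projA i j"
abbreviation q where "q \<equiv> projV i j"

lemma decompose: "i (p e) + j (q e) = e"
  using spanning proj_simps by metis

lemma proj_i [simp]: "p (i a) = a" "q (i a) = 0"
  using proj_simps[of a 0] by (simp_all add: j.zero)

lemma proj_j [simp]: "p (j x) = 0" "q (j x) = x"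
  using proj_simps[of 0 x] by (simp_all add: i.zero)

lemma linear_proj: "Vector_Spaces.linear sE sA p" "Vector_Spaces.linear sE sV q"
proof -
  have "p (e + f) = p e + p f \<and> q (e + f) = q e + q f" for e f
  proof -
    have "e + f = i (p e + p f) + j (q e + q f)"
      using decompose[of e] decompose[of f] by (simp add: i.add j.add algebra_simps)
    then show ?thesis by (metis proj_simps)
  qed
  moreover have "p (sE c e) = sA c (p e) \<and> q (sE c e) = sV c (q e)" for c e
  proof -
    have "sE c e = i (sA c (p e)) + j (sV c (q e))"
      using decompose[of e] by (metis i.scale j.scale i.vs2.scale_right_distrib)
    then show ?thesis by (metis proj_simps)
  qed
  ultimately show "Vector_Spaces.linear sE sA p" "Vector_Spaces.linear sE sV q"
    by (simp_all add: Vector_Spaces.linear_iff i.vs1.vector_space_axioms i.vs2.vector_space_axioms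
        j.vs1.vector_space_axioms)
qed

lemmas spaces = i.vs1.vector_space_axioms j.vs1.vector_space_axioms i.vs2.vector_space_axioms
lemmas lin = linear_proj i.linear_axioms j.linear_axioms

lemma tensor_decompose:
  assumes "t \<in> tensor_space sE sE"
  shows "t = tensor_map sE sE i i (tensor_map sA sA p p t) + tensor_map sE sE j i (tensor_map sV sA q p t)
    + tensor_map sE sE i j (tensor_map sA sV p q t) + tensor_map sE sE j j (tensor_map sV sV q q t)"
    (is "t = ?F t")
proof (rule tensor_space_linear_eqI[OF linear_id[OF vector_space_tscale] _ _ assms])
  show "Vector_Spaces.linear tscale tscale ?F"
    by (simp add: Vector_Spaces.linear_iff vector_space_tscale tensor_map_add
        tensor_map_tscale[unfolded tscale_def] fun_eq_iff tscale_def algebra_simps)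
  fix a b
  note add = bilinear_add[OF bilinear_pure[OF spaces(3) spaces(3)]]
  have "pure sE sE a b = pure sE sE (i (p a) + j (q a)) (i (p b) + j (q b))"
    by (simp add: decompose)
  also have "\<dots> = ?F (pure sE sE a b)"
    by (simp only: add tensor_map_pure[OF lin(1) lin(1)] tensor_map_pure[OF lin(1) lin(2)]
        tensor_map_pure[OF lin(2) lin(1)] tensor_map_pure[OF lin(2) lin(2)]
        tensor_map_pure[OF lin(3) lin(3)] tensor_map_pure[OF lin(3) lin(4)]
        tensor_map_pure[OF lin(4) lin(3)] tensor_map_pure[OF lin(4) lin(4)] ac_simps)
  finally show "pure sE sE a b = ?F (pure sE sE a b)" .
qed

lemma tensor_map_pp:
  shows "t \<in> tensor_space sA sA \<Longrightarrow> tensor_map sA sA p p (tensor_map sE sE i i t) = t"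
    and "t1 \<in> tensor_space sA sV \<Longrightarrow> tensor_map sA sA p p (tensor_map sE sE i j t1) = 0"
    and "t2 \<in> tensor_space sV sA \<Longrightarrow> tensor_map sA sA p p (tensor_map sE sE j i t2) = 0"
    and "t3 \<in> tensor_space sV sV \<Longrightarrow> tensor_map sA sA p p (tensor_map sE sE j j t3) = 0"
  by (simp_all add: tensor_map_compose[OF lin(3) lin(3) lin(1) lin(1)]
      tensor_map_compose[OF lin(3) lin(4) lin(1) lin(1)] tensor_map_compose[OF lin(4) lin(3) lin(1) lin(1)]
      tensor_map_compose[OF lin(4) lin(4) lin(1) lin(1)] tensor_map_id spaces tensor_map_zero
      linear_id linear_const_0)

lemma varphi_i: "Vector_Spaces.linear sV sA r \<Longrightarrow> Vector_Spaces.linear sV sV s \<Longrightarrow> varphi i j r s (i a) = i a"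
  by (simp add: varphi_def linear_zero j.zero)

lemma fixing_eq_varphi:
  assumes \<phi>: "Vector_Spaces.linear sE sE \<phi>" and fixes_A: "\<forall>a. \<phi> (i a) = i a"
  shows "\<phi> = varphi i j (\<lambda>x. p (\<phi> (j x))) (\<lambda>x. q (\<phi> (j x)))"
proof
  fix e
  have "\<phi> e = \<phi> (i (p e) + j (q e))" by (simp add: decompose)
  also have "\<dots> = i (p e) + (i (p (\<phi> (j (q e)))) + j (q (\<phi> (j (q e)))))"
    using \<phi> fixes_A by (simp only: Vector_Spaces.linear_iff decompose[of "\<phi> _"])
  finally show "\<phi> e = varphi i j (\<lambda>x. p (\<phi> (j x))) (\<lambda>x. q (\<phi> (j x))) e"
    by (simp add: varphi_def i.add ac_simps)
qed

lemma ex_varphi_iff: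
  assumes "\<And>\<phi>. R \<phi> \<Longrightarrow> Vector_Spaces.linear sE sE \<phi>"
  shows "(\<exists>r s. Vector_Spaces.linear sV sA r \<and> Vector_Spaces.linear sV sV s \<and> R (varphi i j r s))
    \<longleftrightarrow> (\<exists>\<phi>. R \<phi> \<and> (\<forall>a. \<phi> (i a) = i a))" (is "?L \<longleftrightarrow> ?R")
proof
  show ?L if ?R
  proof -
    from that obtain \<phi> where \<phi>: "R \<phi>" "\<forall>a. \<phi> (i a) = i a" by (elim exE conjE)
    note l = assms[OF \<phi>(1)]
    have "Vector_Spaces.linear sV sA (\<lambda>x. p (\<phi> (j x)))" "Vector_Spaces.linear sV sV (\<lambda>x. q (\<phi> (j x)))"
      using l lin by (simp_all add: Vector_Spaces.linear_iff)
    moreover have "R (varphi i j (\<lambda>x. p (\<phi> (j x))) (\<lambda>x. q (\<phi> (j x))))"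
      using \<phi>(1) by (subst (asm) fixing_eq_varphi[OF l \<phi>(2)])
    ultimately show ?thesis by (intro exI conjI)
  qed
  show ?R if ?L
    using that by (elim exE conjE) (rule exI, rule conjI, assumption, simp add: varphi_i)
qed

end

section \<open>Extensions as unified products\<close>

locale complemented_bialgebra =
  A: alternative_bialgebra sA multA comultA + complemented_subspace sA sV sE i j
  for sA :: "'k::field_char_0 \<Rightarrow> 'a::ab_group_add \<Rightarrow> 'a"
    and multA :: "'a \<Rightarrow> 'a \<Rightarrow> 'a" and comultA :: "'a \<Rightarrow> ('k, 'a, 'a) tensor"
    and sV :: "'k \<Rightarrow> 'v::ab_group_add \<Rightarrow> 'v"
    and sE :: "'k \<Rightarrow> 'e::ab_group_add \<Rightarrow> 'e"
    and i :: "'a \<Rightarrow> 'e" and j :: "'v \<Rightarrow> 'e"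
begin

abbreviation "S \<equiv> (multA, comultA)"
abbreviation "data \<equiv> IB1 sA sV sE i j S <+> IB2 sA sV sE i j S"

lemma unified1_in_extensions:
  assumes "\<Omega> \<in> IB1 sA sV sE i j S"
  shows "unified1 sE i j S \<Omega> \<in> extensions sA sE i j S"
proof -
  have t: "comultA a \<in> tensor_space sA sA" "phi1 \<Omega> a \<in> tensor_space sV sA"
    "psi1 \<Omega> a \<in> tensor_space sA sV" "P1 \<Omega> a \<in> tensor_space sV sV"
    "comult1 \<Omega> x \<in> tensor_space sV sV" "rho1 \<Omega> x \<in> tensor_space sA sV"
    "gamma1 \<Omega> x \<in> tensor_space sV sA" for a x
    using assms A.linear_comult by (simp_all add: IB1_def linear_into_tensor_def)
  have "bialgebra_hom sE (unified1 sE i j S \<Omega>) sA S p"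
    using t by (simp add: bialgebra_hom_def unified1_def Let_def linear_proj proj_simps
        tensor_map_add tensor_map_pp)
  then show ?thesis using assms by (simp add: extensions_def IB1_def)
qed

lemma unified2_in_extensions:
  assumes "\<Omega> \<in> IB2 sA sV sE i j S"
  shows "unified2 sE i j S \<Omega> \<in> extensions sA sE i j S"
proof -
  have z: "lharp2 \<Omega> 0 a = 0" "rharp2 \<Omega> a 0 = 0" "lact2 \<Omega> a 0 = 0" "ract2 \<Omega> 0 a = 0"
    "sigma2 \<Omega> 0 0 = 0" "mult2 \<Omega> 0 0 = 0" for a
    using assms by (auto simp: IB2_def intro: bilinear_zero)
  have z': "rho2 \<Omega> 0 = 0" "gamma2 \<Omega> 0 = 0" "Q2 \<Omega> 0 = 0" "comult2 \<Omega> 0 = 0"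
    using assms by (auto simp: IB2_def intro: linear_into_tensor_0)
  have "bialgebra_hom sA S sE (unified2 sE i j S \<Omega>) i"
    by (simp add: bialgebra_hom_def unified2_def i.linear_axioms z z' tensor_map_0 j.zero)
  then show ?thesis using assms by (simp add: extensions_def IB2_def)
qed

context
  fixes multE :: "'e \<Rightarrow> 'e \<Rightarrow> 'e" and comultE :: "'e \<Rightarrow> ('k, 'e, 'e) tensor"
  assumes bialg: "alternative_bialgebra sE multE comultE"
begin

interpretation E: alternative_bialgebra sE multE comultE by (rule bialg)

definition components1 :: "('k, 'a, 'v) datum1" where
  "components1 = \<lparr>lact1 = \<lambda>a x. q (multE (i a) (j x)), ract1 = \<lambda>x a. q (multE (j x) (i a)),
    phi1 = \<lambda>a. tensor_map sV sA q p (comultE (i a)), psi1 = \<lambda>a. tensor_map sA sV p q (comultE (i a)),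
    rho1 = \<lambda>x. tensor_map sA sV p q (comultE (j x)), gamma1 = \<lambda>x. tensor_map sV sA q p (comultE (j x)),
    theta1 = \<lambda>a b. q (multE (i a) (i b)), P1 = \<lambda>a. tensor_map sV sV q q (comultE (i a)),
    mult1 = \<lambda>x y. q (multE (j x) (j y)), comult1 = \<lambda>x. tensor_map sV sV q q (comultE (j x))\<rparr>"

definition components2 :: "('k, 'a, 'v) datum2" where
  "components2 = \<lparr>lharp2 = \<lambda>x a. p (multE (j x) (i a)), rharp2 = \<lambda>a x. p (multE (i a) (j x)),
    lact2 = \<lambda>a x. q (multE (i a) (j x)), ract2 = \<lambda>x a. q (multE (j x) (i a)),
    sigma2 = \<lambda>x y. p (multE (j x) (j y)),
    rho2 = \<lambda>x. tensor_map sA sV p q (comultE (j x)), gamma2 = \<lambda>x. tensor_map sV sA q p (comultE (j x)),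
    Q2 = \<lambda>x. tensor_map sA sA p p (comultE (j x)),
    mult2 = \<lambda>x y. q (multE (j x) (j y)), comult2 = \<lambda>x. tensor_map sV sV q q (comultE (j x))\<rparr>"

lemma multE_decompose:
  "multE e f = multE (i (p e)) (i (p f)) + multE (i (p e)) (j (q f))
    + multE (j (q e)) (i (p f)) + multE (j (q e)) (j (q f))"
proof -
  have "multE e f = multE (i (p e) + j (q e)) (i (p f) + j (q f))" by (simp add: decompose)
  then show ?thesis by (simp only: bilinear_add[OF E.bilinear_mult] ac_simps)
qed

lemma comultE_decompose: "comultE e = comultE (i (p e)) + comultE (j (q e))"
  using E.linear_comult decompose[of e] by (metis linear_into_tensor_def Vector_Spaces.linear_iff)

lemma comultE_components:
  "comultE e = tensor_map sE sE i i (tensor_map sA sA p p (comultE e))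
    + tensor_map sE sE j i (tensor_map sV sA q p (comultE e))
    + tensor_map sE sE i j (tensor_map sA sV p q (comultE e))
    + tensor_map sE sE j j (tensor_map sV sV q q (comultE e))"
  using E.linear_comult by (intro tensor_decompose) (simp add: linear_into_tensor_def)

lemma unified1_components1:
  assumes "bialgebra_hom sE (multE, comultE) sA S p"
  shows "unified1 sE i j S components1 = (multE, comultE)"
proof -
  have pm: "p (multE e f) = multA (p e) (p f)" and pc: "tensor_map sA sA p p (comultE e) = comultA (p e)"
    for e f using assms by (auto simp: bialgebra_hom_def)
  have "i (multA (p e) (p f)) + j (q (multE (j (q e)) (j (q f))) + q (multE (i (p e)) (j (q f)))
    + q (multE (j (q e)) (i (p f))) + q (multE (i (p e)) (i (p f)))) = multE e f" for e f
  proof -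
    have "q (multE e f) = q (multE (j (q e)) (j (q f))) + q (multE (i (p e)) (j (q f)))
      + q (multE (j (q e)) (i (p f))) + q (multE (i (p e)) (i (p f)))"
      using lin(2) by (subst multE_decompose) (simp add: Vector_Spaces.linear_iff ac_simps)
    then show ?thesis using decompose[of "multE e f"] by (simp add: pm)
  qed
  moreover have "comultE e = (tensor_map sE sE i i (comultA (p e))
      + tensor_map sE sE j i (tensor_map sV sA q p (comultE (i (p e))))
      + tensor_map sE sE i j (tensor_map sA sV p q (comultE (i (p e))))
      + tensor_map sE sE j j (tensor_map sV sV q q (comultE (i (p e)))))
    + (tensor_map sE sE j j (tensor_map sV sV q q (comultE (j (q e))))
      + tensor_map sE sE i j (tensor_map sA sV p q (comultE (j (q e))))
      + tensor_map sE sE j i (tensor_map sV sA q p (comultE (j (q e)))))" for e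
  proof -
    have "tensor_map sA sA p p (comultE (j (q e))) = 0"
      using linear_into_tensor_0[OF A.linear_comult] by (simp add: pc)
    then show ?thesis
      using comultE_decompose[of e] comultE_components[of "i (p e)"] comultE_components[of "j (q e)"]
      by (simp add: pc tensor_map_0 ac_simps)
  qed
  ultimately show ?thesis by (simp add: unified1_def components1_def Let_def fun_eq_iff)
qed

lemma unified2_components2:
  assumes "bialgebra_hom sA S sE (multE, comultE) i"
  shows "unified2 sE i j S components2 = (multE, comultE)"
proof -
  have im: "multE (i a) (i b) = i (multA a b)" and ic: "comultE (i a) = tensor_map sE sE i i (comultA a)"
    for a b using assms by (auto simp: bialgebra_hom_def)
  have "i (multA (p e) (p f) + p (multE (j (q e)) (i (p f))) + p (multE (i (p e)) (j (q f)))
      + p (multE (j (q e)) (j (q f))))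
    + j (q (multE (j (q e)) (j (q f))) + q (multE (j (q e)) (i (p f))) + q (multE (i (p e)) (j (q f))))
    = multE e f" for e f
  proof -
    have "p (multE e f) = multA (p e) (p f) + p (multE (j (q e)) (i (p f)))
        + p (multE (i (p e)) (j (q f))) + p (multE (j (q e)) (j (q f)))"
      "q (multE e f) = q (multE (j (q e)) (j (q f))) + q (multE (j (q e)) (i (p f)))
        + q (multE (i (p e)) (j (q f)))"
      using lin(1,2) by (subst multE_decompose, simp add: Vector_Spaces.linear_iff im ac_simps)+
    then show ?thesis using decompose[of "multE e f"] by simp
  qed
  moreover have "comultE e = tensor_map sE sE i i (comultA (p e))
    + (tensor_map sE sE j j (tensor_map sV sV q q (comultE (j (q e))))
      + tensor_map sE sE i j (tensor_map sA sV p q (comultE (j (q e))))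
      + tensor_map sE sE j i (tensor_map sV sA q p (comultE (j (q e))))
      + tensor_map sE sE i i (tensor_map sA sA p p (comultE (j (q e)))))" for e
    using comultE_decompose[of e] comultE_components[of "j (q e)"] by (simp add: ic ac_simps)
  ultimately show ?thesis by (simp add: unified2_def components2_def Let_def fun_eq_iff)
qed

lemmas bilinear_components =
  linear_bilinear_compose[OF _ bilinear_compose[OF E.bilinear_mult]]

lemma components1_in_IB1:
  assumes "bialgebra_hom sE (multE, comultE) sA S p"
  shows "components1 \<in> IB1 sA sV sE i j S"
  unfolding IB1_def mem_Collect_eq unified1_components1[OF assms]
  by (auto simp: components1_def bialg
    intro!: bilinear_components linear_into_tensor_compose[OF E.linear_comult] lin)

lemma components2_in_IB2:
  assumes "bialgebra_hom sA S sE (multE, comultE) i"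
  shows "components2 \<in> IB2 sA sV sE i j S"
  unfolding IB2_def mem_Collect_eq unified2_components2[OF assms]
  by (auto simp: components2_def bialg
    intro!: bilinear_components linear_into_tensor_compose[OF E.linear_comult] lin)

end

lemma unified_image: "unified sE i j S ` data = extensions sA sE i j S"
proof
  show "unified sE i j S ` data \<subseteq> extensions sA sE i j S"
    by (auto simp: unified_def unified1_in_extensions unified2_in_extensions)
  show "extensions sA sE i j S \<subseteq> unified sE i j S ` data"
  proof
    fix T assume T: "T \<in> extensions sA sE i j S"
    obtain m \<Delta> where [simp]: "T = (m, \<Delta>)" by fastforce
    have b: "alternative_bialgebra sE m \<Delta>" using T by (simp add: extensions_def)
    consider "bialgebra_hom sA S sE (m, \<Delta>) i" | "bialgebra_hom sE (m, \<Delta>) sA S p"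
      using T by (auto simp: extensions_def)
    then show "T \<in> unified sE i j S ` data"
    proof cases
      case 1
      then have "unified sE i j S (Inr (components2 m \<Delta>)) = T"
        using unified2_components2[OF b] by (simp add: unified_def)
      then show ?thesis using components2_in_IB2[OF b 1] by blast
    next
      case 2
      then have "unified sE i j S (Inl (components1 m \<Delta>)) = T"
        using unified1_components1[OF b] by (simp add: unified_def)
      then show ?thesis using components1_in_IB1[OF b 2] by blast
    qed
  qed
qed

lemma datum_equiv_iff:
  assumes "\<Omega> \<in> data" "\<Omega>' \<in> data"
  shows "(\<Omega>, \<Omega>') \<in> datum_equiv sA sV sE i j S
    \<longleftrightarrow> (unified sE i j S \<Omega>, unified sE i j S \<Omega>') \<in> extension_equiv sA sE i j S"
proof -
  have "unified sE i j S \<Omega> \<in> extensions sA sE i j S" "unified sE i j S \<Omega>' \<in> extensions sA sE i j S"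
    using assms unified_image by blast+
  then show ?thesis
    using assms ex_varphi_iff[of "bialgebra_iso sE (unified sE i j S \<Omega>) sE (unified sE i j S \<Omega>')"]
    by (simp add: datum_equiv_def extension_equiv_def bialgebra_iso_def bialgebra_hom_def)
qed

end

lemma quotient_pullback:
  assumes surj: "U ` D = X" and R: "R \<subseteq> D \<times> D" and Q: "Q \<subseteq> X \<times> X"
    and pullback: "\<And>a b. a \<in> D \<Longrightarrow> b \<in> D \<Longrightarrow> (a, b) \<in> R \<longleftrightarrow> (U a, U b) \<in> Q"
  shows "a \<in> D \<Longrightarrow> U ` (R `` {a}) = Q `` {U a}"
    and "bij_betw (image U) (D // R) (X // Q)"
proof -
  have img: "U ` (R `` {a}) = Q `` {U a}"
    and saturated: "R `` {a} = {b \<in> D. U b \<in> Q `` {U a}}" if "a \<in> D" for a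
  proof -
    have mem: "b \<in> R `` {a} \<longleftrightarrow> b \<in> D \<and> U b \<in> Q `` {U a}" for b
      using R pullback[OF that, of b] by blast
    then show "R `` {a} = {b \<in> D. U b \<in> Q `` {U a}}" by blast
    then show "U ` (R `` {a}) = Q `` {U a}" using Q surj by blast
  qed
  then show "a \<in> D \<Longrightarrow> U ` (R `` {a}) = Q `` {U a}" by blast
  have "inj_on (image U) (D // R)"
  proof (rule inj_onI)
    fix B C assume "B \<in> D // R" "C \<in> D // R" and eq: "U ` B = U ` C"
    then obtain b c where bc: "b \<in> D" "B = R `` {b}" "c \<in> D" "C = R `` {c}"
      by (metis quotientE)
    then have "Q `` {U b} = Q `` {U c}" using eq img by metis
    then show "B = C" unfolding bc(2,4) saturated[OF bc(1)] saturated[OF bc(3)] by (rule arg_cong)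
  qed
  moreover have "image U ` (D // R) = (\<lambda>a. Q `` {U a}) ` D"
    by (auto simp: quotient_def image_Union img)
  moreover have "(\<lambda>a. Q `` {U a}) ` D = X // Q"
    unfolding surj[symmetric] by (auto simp: quotient_def)
  ultimately show "bij_betw (image U) (D // R) (X // Q)" by (simp add: bij_betw_def)
qed

theorem theorem5p17:
  fixes sA :: "'k::field_char_0 \<Rightarrow> 'a::ab_group_add \<Rightarrow> 'a"
    and sV :: "'k \<Rightarrow> 'v::ab_group_add \<Rightarrow> 'v"
    and sE :: "'k \<Rightarrow> 'e::ab_group_add \<Rightarrow> 'e"
    and i :: "'a \<Rightarrow> 'e" and j :: "'v \<Rightarrow> 'e"
    and multA :: "'a \<Rightarrow> 'a \<Rightarrow> 'a" and comultA :: "'a \<Rightarrow> ('k, 'a, 'a) tensor"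
  assumes "alternative_bialgebra sA multA comultA"
    and "complemented_subspace sA sV sE i j"
  shows "\<exists>\<Upsilon>.
    (\<forall>\<Omega> \<in> IB1 sA sV sE i j (multA, comultA).
      \<Upsilon> (datum_equiv sA sV sE i j (multA, comultA) `` {Inl \<Omega>}) =
        extension_equiv sA sE i j (multA, comultA) `` {unified1 sE i j (multA, comultA) \<Omega>}) \<and>
    (\<forall>\<Omega> \<in> IB2 sA sV sE i j (multA, comultA).
      \<Upsilon> (datum_equiv sA sV sE i j (multA, comultA) `` {Inr \<Omega>}) =
        extension_equiv sA sE i j (multA, comultA) `` {unified2 sE i j (multA, comultA) \<Omega>}) \<and>
    bij_betw \<Upsilon> (HLB sA sV sE i j (multA, comultA)) (BExtd sA sE i j (multA, comultA))"
proof -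
  interpret complemented_bialgebra sA multA comultA sV sE i j
    using assms by (rule complemented_bialgebra.intro)
  have sub: "datum_equiv sA sV sE i j S \<subseteq> data \<times> data"
    "extension_equiv sA sE i j S \<subseteq> extensions sA sE i j S \<times> extensions sA sE i j S"
    by (auto simp: datum_equiv_def extension_equiv_def)
  have image_class: "image (unified sE i j S) (datum_equiv sA sV sE i j S `` {\<Omega>}) =
      extension_equiv sA sE i j S `` {unified sE i j S \<Omega>}" if "\<Omega> \<in> data" for \<Omega>
    using that by (intro quotient_pullback(1)[OF unified_image sub] datum_equiv_iff)
  show ?thesis
  proof (intro exI conjI ballI)
    show "bij_betw (image (unified sE i j S)) (HLB sA sV sE i j S) (BExtd sA sE i j S)"
      unfolding HLB_def BExtd_def
      by (intro quotient_pullback(2)[OF unified_image sub] datum_equiv_iff)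
  qed (use image_class[OF InlI] image_class[OF InrI] in \<open>auto simp only: unified_def sum.case\<close>)
qed

end
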